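(* Let $n\ge 2$, let $P_n$ be the path graph on $n$ vertices with vertex set $\{1,\dots,n\}$, and let $m$ be a vertex. Suppose $n=2m-1$. Then $\mathcal{T}_2(P_n,m)=\mathcal{T}_3(P_n,m)=\mathcal{T}_4(P_n,m)\cong M_m(\mathbb{C})\oplus M_{m-1}(\mathbb{C})$ as $\mathbb{C}$-algebras. In particular, $\dim\mathcal{T}_2(P_n,m)=\dim\mathcal{T}_3(P_n,m)=\dim\mathcal{T}_4(P_n,m)=2m^2-2m+1=(n^2+1)/2$.
   Context: $P_n$ has vertex set $X=\{1,2,\dots,n\}$ and edge set $\{\{i,j\}: |i-j|=1\}$. For a finite connected simple graph $\Gamma$ on $X$ with adjacency matrix $A$ and base vertex $x_0\in X$, $M_X(\mathbb{C})$ is the algebra of complex matrices with rows and columns indexed by $X$. For $Y\subset X$, $E_Y$ is the diagonal matrix with $(x,x)$-entry $1$ if $x\in Y$ and $0$ otherwise. $\mathbb{C}\langle S\rangle$ is the unital $\mathbb{C}$-subalgebra of $M_X(\mathbb{C})$ generated by $S$. Let $X_k=\{x\in X:\partial(x_0,x)=k\}$ ($\partial$ the graph distance), $D=\max_{x}\partial(x_0,x)$, $G_{x_0}$ the stabilizer of $x_0$ in $\mathrm{Aut}(\Gamma)$, and $Y_1,\dots,Y_r$ the $G_{x_0}$-orbits on $X$. Then $\mathcal{T}_2(\Gamma,x_0)=\mathbb{C}\langle A,E_{X_0},\dots,E_{X_D}\rangle$, $\mathcal{T}_3(\Gamma,x_0)=\mathbb{C}\langle A,E_{Y_1},\dots,E_{Y_r}\rangle$,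 and $\mathcal{T}_4(\Gamma,x_0)=\{M\in M_X(\mathbb{C}): M_{\sigma(x),\sigma(y)}=M_{x,y}\ \text{for all } x,y\in X,\ \sigma\in G_{x_0}\}$. *)

theory Defs
  imports
    "Jordan_Normal_Form.VS_Connect"
    "HOL-Algebra.Chinese_Remainder"
    "HOL-Algebra.Subrings"
begin

section \<open>Complex algebras\<close>

text \<open>A complex algebra is given by a \<open>module\<close> record over \<open>class_ring :: complex ring\<close>; the
  fields \<open>mult\<close> and \<open>one\<close> that the record inherits from \<open>ring\<close> are its product and unit. The
  record \<open>module_mat TYPE(complex) k k\<close> is in this sense the full matrix algebra.\<close>

abbreviation complex_field :: "complex ring" where
  "complex_field \<equiv> class_ring"

abbreviation mat_algebra :: "nat \<Rightarrow> (complex, complex mat) module" where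
  "mat_algebra k \<equiv> module_mat TYPE(complex) k k"

text \<open>The predicate \<open>subring\<close> includes membership of the unit, so this is the least unital
  subalgebra containing \<open>S\<close>.\<close>

definition generated_algebra ::
  "('a, 'c) ring_scheme \<Rightarrow> ('a, 'b, 'd) module_scheme \<Rightarrow> 'b set \<Rightarrow> 'b set" where
  "generated_algebra K M S =
     \<Inter> {B. subring B M \<and>
           (\<forall>c \<in> carrier K. \<forall>x \<in> B. c \<odot>\<^bsub>M\<^esub> x \<in> B) \<and> S \<subseteq> B}"

definition algebra_direct_sum ::
  "('a, 'b, 'd) module_scheme \<Rightarrow> ('a, 'c, 'e) module_scheme \<Rightarrow> ('a, 'b \<times> 'c) module" where
  "algebra_direct_sum M N =
     ring.extend (RDirProd M N) (module.fields (\<lambda>c (x, y). (c \<odot>\<^bsub>M\<^esub> x, c \<odot>\<^bsub>N\<^esub> y)))"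

lemma algebra_direct_sum_simps:
  "carrier (algebra_direct_sum M N) = carrier M \<times> carrier N"
  "(a, b) \<otimes>\<^bsub>algebra_direct_sum M N\<^esub> (a', b') = (a \<otimes>\<^bsub>M\<^esub> a', b \<otimes>\<^bsub>N\<^esub> b')"
  "(a, b) \<oplus>\<^bsub>algebra_direct_sum M N\<^esub> (a', b') = (a \<oplus>\<^bsub>M\<^esub> a', b \<oplus>\<^bsub>N\<^esub> b')"
  "\<one>\<^bsub>algebra_direct_sum M N\<^esub> = (\<one>\<^bsub>M\<^esub>, \<one>\<^bsub>N\<^esub>)"
  "\<zero>\<^bsub>algebra_direct_sum M N\<^esub> = (\<zero>\<^bsub>M\<^esub>, \<zero>\<^bsub>N\<^esub>)"
  "c \<odot>\<^bsub>algebra_direct_sum M N\<^esub> (a, b) = (c \<odot>\<^bsub>M\<^esub> a, c \<odot>\<^bsub>N\<^esub> b)"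
  by (simp_all add: algebra_direct_sum_def RDirProd_def DirProd_def
      ring.defs module.defs monoid.defs)

definition algebra_isomorphic ::
  "('a, 'f) ring_scheme \<Rightarrow> ('a, 'b, 'd) module_scheme \<Rightarrow> ('a, 'c, 'e) module_scheme \<Rightarrow> bool" where
  "algebra_isomorphic K M N \<longleftrightarrow>
     (\<exists>h. h \<in> ring_iso M N \<and> h \<in> LinearCombinations.module_hom K M N)"


section \<open>Graphs on \<open>{1..n}\<close>\<close>

text \<open>A graph is given by \<open>n\<close>, which determines its vertex set \<open>{1..n}\<close>, and its set \<open>E\<close> of
  edges, which are two-element sets of vertices.\<close>

abbreviation vertices :: "nat \<Rightarrow> nat set" where
  "vertices n \<equiv> {1..n}"

definition adj_rel :: "nat set set \<Rightarrow> nat rel" where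
  "adj_rel E = {(x, y). {x, y} \<in> E}"

definition connected_simple_graph :: "nat \<Rightarrow> nat set set \<Rightarrow> bool" where
  "connected_simple_graph n E \<longleftrightarrow>
     (\<forall>e \<in> E. e \<subseteq> vertices n \<and> card e = 2) \<and>
     (\<forall>x \<in> vertices n. \<forall>y \<in> vertices n. (x, y) \<in> (adj_rel E)\<^sup>*)"

text \<open>In \<open>adj_rel E ^^ k\<close> are the pairs joined by a walk with \<open>k\<close> edges.\<close>

definition graph_dist :: "nat set set \<Rightarrow> nat \<Rightarrow> nat \<Rightarrow> nat" where
  "graph_dist E x y = (LEAST k. (x, y) \<in> adj_rel E ^^ k)"

definition eccentricity :: "nat \<Rightarrow> nat set set \<Rightarrow> nat \<Rightarrow> nat" where
  "eccentricity n E x0 = Max (graph_dist E x0 ` vertices n)"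

definition dist_layer :: "nat \<Rightarrow> nat set set \<Rightarrow> nat \<Rightarrow> nat \<Rightarrow> nat set" where
  "dist_layer n E x0 k = {x \<in> vertices n. graph_dist E x0 x = k}"

definition graph_aut :: "nat \<Rightarrow> nat set set \<Rightarrow> (nat \<Rightarrow> nat) set" where
  "graph_aut n E = {\<sigma>. \<sigma> permutes vertices n \<and>
     (\<forall>x \<in> vertices n. \<forall>y \<in> vertices n. {\<sigma> x, \<sigma> y} \<in> E \<longleftrightarrow> {x, y} \<in> E)}"

definition aut_stabilizer :: "nat \<Rightarrow> nat set set \<Rightarrow> nat \<Rightarrow> (nat \<Rightarrow> nat) set" where
  "aut_stabilizer n E x0 = {\<sigma> \<in> graph_aut n E. \<sigma> x0 = x0}"

definition stabilizer_orbits :: "nat \<Rightarrow> nat set set \<Rightarrow> nat \<Rightarrow> nat set set" where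
  "stabilizer_orbits n E x0 = {{\<sigma> x | \<sigma>. \<sigma> \<in> aut_stabilizer n E x0} | x. x \<in> vertices n}"


section \<open>The algebras attached to a graph and a base vertex\<close>

text \<open>Matrices of type \<open>mat\<close> are indexed from \<open>0\<close>: vertex \<open>x\<close> has row and column index \<open>x - 1\<close>.
  The next two operations translate to and from indices in \<open>{1..n}\<close>.\<close>

definition vertex_mat :: "nat \<Rightarrow> (nat \<Rightarrow> nat \<Rightarrow> complex) \<Rightarrow> complex mat" where
  "vertex_mat n f = mat n n (\<lambda>(i, j). f (i + 1) (j + 1))"

definition vertex_entry :: "complex mat \<Rightarrow> nat \<Rightarrow> nat \<Rightarrow> complex" where
  "vertex_entry M x y = M $$ (x - 1, y - 1)"

definition adjacency_mat :: "nat \<Rightarrow> nat set set \<Rightarrow> complex mat" where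
  "adjacency_mat n E = vertex_mat n (\<lambda>x y. if {x, y} \<in> E then 1 else 0)"

definition proj_mat :: "nat \<Rightarrow> nat set \<Rightarrow> complex mat" where
  "proj_mat n Y = vertex_mat n (\<lambda>x y. if x = y \<and> x \<in> Y then 1 else 0)"

definition T2 :: "nat \<Rightarrow> nat set set \<Rightarrow> nat \<Rightarrow> complex mat set" where
  "T2 n E x0 = generated_algebra complex_field (mat_algebra n)
     ({adjacency_mat n E} \<union> {proj_mat n (dist_layer n E x0 k) | k. k \<le> eccentricity n E x0})"

definition T3 :: "nat \<Rightarrow> nat set set \<Rightarrow> nat \<Rightarrow> complex mat set" where
  "T3 n E x0 = generated_algebra complex_field (mat_algebra n)
     ({adjacency_mat n E} \<union> {proj_mat n Y | Y. Y \<in> stabilizer_orbits n E x0})"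

definition T4 :: "nat \<Rightarrow> nat set set \<Rightarrow> nat \<Rightarrow> complex mat set" where
  "T4 n E x0 = {M \<in> carrier_mat n n.
     \<forall>x \<in> vertices n. \<forall>y \<in> vertices n. \<forall>\<sigma> \<in> aut_stabilizer n E x0.
       vertex_entry M (\<sigma> x) (\<sigma> y) = vertex_entry M x y}"

abbreviation mat_subalgebra :: "nat \<Rightarrow> complex mat set \<Rightarrow> (complex, complex mat) module" where
  "mat_subalgebra n B \<equiv> (mat_algebra n)\<lparr>carrier := B\<rparr>"

text \<open>Vector space dimension over the complex numbers, for linear subspaces \<open>B\<close>.\<close>

abbreviation mat_dim :: "nat \<Rightarrow> complex mat set \<Rightarrow> nat" where
  "mat_dim n B \<equiv> vectorspace.dim complex_field (mat_subalgebra n B)"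


section \<open>The path graph\<close>

definition path_edges :: "nat \<Rightarrow> nat set set" where
  "path_edges n = {{i, j} | i j. i \<in> vertices n \<and> j \<in> vertices n \<and> \<bar>int i - int j\<bar> = 1}"

lemma path_adj_rel:
  "(x, y) \<in> adj_rel (path_edges n) \<longleftrightarrow>
     x \<in> vertices n \<and> y \<in> vertices n \<and> \<bar>int x - int y\<bar> = 1"
  unfolding adj_rel_def path_edges_def by (auto simp: doubleton_eq_iff)

lemma path_connected_simple_graph: "connected_simple_graph n (path_edges n)"
proof -
  have up: "(x, x + d) \<in> (adj_rel (path_edges n))\<^sup>* \<and> (x + d, x) \<in> (adj_rel (path_edges n))\<^sup>*"
    if "1 \<le> x" "x + d \<le> n" for x d
    using that
  proof (induction d)
    case (Suc d)
    then have "(x + d, x + Suc d) \<in> adj_rel (path_edges n)"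
      "(x + Suc d, x + d) \<in> adj_rel (path_edges n)"
      by (auto simp: path_adj_rel)
    moreover have "(x, x + d) \<in> (adj_rel (path_edges n))\<^sup>*"
      "(x + d, x) \<in> (adj_rel (path_edges n))\<^sup>*"
      using Suc by auto
    ultimately show ?case
      by (blast intro: rtrancl_into_rtrancl converse_rtrancl_into_rtrancl)
  qed auto
  have "(x, y) \<in> (adj_rel (path_edges n))\<^sup>*" if "x \<in> vertices n" "y \<in> vertices n" for x y
  proof (cases "x \<le> y")
    case True
    then show ?thesis using up[of x "y - x"] that by auto
  next
    case False
    then show ?thesis using up[of y "x - y"] that by auto
  qed
  moreover have "e \<subseteq> vertices n \<and> card e = 2" if "e \<in> path_edges n" for e
    using that unfolding path_edges_def by (auto simp: card_insert_if)
  ultimately show ?thesis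
    unfolding connected_simple_graph_def by blast
qed

end

theory Submission
  imports Defs
begin

text \<open>The stabilizer of the middle vertex is generated by the reflection of the path, so its orbits
  are the distance layers and \<open>T4\<close> consists of the centrosymmetric matrices. The latter are spanned by
  the matrices \<open>C\<^bsub>ij\<^esub> = E\<^bsub>ij\<^esub> + E\<^bsub>\<rho>i,\<rho>j\<^esub>\<close>, where \<open>\<rho>\<close> is the reflection. Cutting the adjacency matrix with
  layer projections yields \<open>C\<^bsub>ij\<^esub>\<close> for neighbours \<open>i\<close>, \<open>j\<close>; products along the path give it for
  vertices on one side of the middle, and products through the middle vertex for the others. A
  centrosymmetric matrix is determined by its actions on the \<open>\<rho>\<close>-symmetric and on the \<open>\<rho>\<close>-skew vectors,
  which are arbitrary matrices of sizes \<open>m\<close> and \<open>m - 1\<close>.\<close>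

section \<open>Automorphisms and distances of the path\<close>

text \<open>The identity branch off the vertex set is what \<open>permutes\<close> demands.\<close>

definition reflection :: "nat \<Rightarrow> nat \<Rightarrow> nat" where
  "reflection n x = (if x \<in> vertices n then Suc n - x else x)"

lemma reflection_permutes: "reflection n permutes vertices n"
  by (rule bij_imp_permutes[OF bij_betwI[where g = "reflection n"]])
    (auto simp: reflection_def)

lemma doubleton_path_edges_iff:
  "{x, y} \<in> path_edges n \<longleftrightarrow> x \<in> vertices n \<and> y \<in> vertices n \<and> \<bar>int x - int y\<bar> = 1"
  using path_adj_rel[of x y n] by (simp add: adj_rel_def)

lemma reflection_graph_aut: "reflection n \<in> graph_aut n (path_edges n)"
  using reflection_permutes
  by (auto simp: graph_aut_def doubleton_path_edges_iff reflection_def of_nat_diff)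

text \<open>The right neighbour of the fixed middle goes to one of the middle's two neighbours. This
  choice of sign propagates outwards: each further vertex goes next to the image of its predecessor,
  and injectivity excludes turning back.\<close>

lemma aut_stabilizer_path_middle:
  "aut_stabilizer (Suc (2 * p)) (path_edges (Suc (2 * p))) (Suc p) = {id, reflection (Suc (2 * p))}"
proof
  let ?n = "Suc (2 * p)" and ?c = "int p + 1"
  show "{id, reflection ?n} \<subseteq> aut_stabilizer ?n (path_edges ?n) (Suc p)"
    using reflection_graph_aut[of ?n]
    by (auto simp: aut_stabilizer_def graph_aut_def reflection_def permutes_id)
  show "aut_stabilizer ?n (path_edges ?n) (Suc p) \<subseteq> {id, reflection ?n}"
  proof
    fix \<sigma> assume \<sigma>: "\<sigma> \<in> aut_stabilizer ?n (path_edges ?n) (Suc p)"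
    then have perm: "\<sigma> permutes vertices ?n" and fixed: "\<sigma> (Suc p) = Suc p"
      and edges: "\<And>x y. x \<in> vertices ?n \<Longrightarrow> y \<in> vertices ?n \<Longrightarrow>
        {\<sigma> x, \<sigma> y} \<in> path_edges ?n \<longleftrightarrow> {x, y} \<in> path_edges ?n"
      by (auto simp: aut_stabilizer_def graph_aut_def)
    have adj: "\<bar>int (\<sigma> x) - int (\<sigma> y)\<bar> = 1"
      if "x \<in> vertices ?n" "y \<in> vertices ?n" "\<bar>int x - int y\<bar> = 1" for x y
      using edges[of x y] that by (auto simp: doubleton_path_edges_iff)
    have inj: "\<sigma> x \<noteq> \<sigma> y" if "x \<noteq> y" for x y
      using permutes_inj[OF perm] that by (auto dest: injD)
    have outside: "\<sigma> x = x" if "x \<notin> vertices ?n" for x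
      using perm that by (simp add: permutes_def)
    \<comment> \<open>The sign \<open>s\<close> tells to which side the right neighbour of the
      middle goes; for \<open>p = 0\<close> there is no neighbour and 1 is an arbitrary
      choice.\<close>
    obtain s :: int where s: "s = 1 \<or> s = -1"
      and right: "0 < p \<Longrightarrow> int (\<sigma> (Suc p + 1)) = ?c + s"
    proof (cases "p = 0")
      case True then show ?thesis using that[of 1] by simp
    next
      case False
      then have "\<bar>int (\<sigma> (Suc p + 1)) - int (\<sigma> (Suc p))\<bar> = 1" by (intro adj) auto
      then show ?thesis using that[of "int (\<sigma> (Suc p + 1)) - ?c"] fixed by (simp add: abs_if split: if_splits)
    qed
    have main: "d \<le> p \<Longrightarrow> int (\<sigma> (Suc p + d)) = ?c + s * int d \<and>
       int (\<sigma> (Suc p - d)) = ?c - s * int d" for d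
    proof (induction d rule: less_induct)
      case (less d)
      \<comment> \<open>At distance 1 on the left the only free place is the one that the right
        neighbour leaves. From distance 2 on, the images at the two preceding distances force the
        next one.\<close>
      consider "d = 0" | "d = 1" | e where "d = Suc (Suc e)" by (metis One_nat_def old.nat.exhaust)
      then show ?case
      proof cases
        case 1 then show ?thesis using fixed by simp
      next
        case 2
        then have p: "0 < p" using less.prems by simp
        have "\<bar>int (\<sigma> (Suc p - 1)) - int (\<sigma> (Suc p))\<bar> = 1" using p by (intro adj) auto
        moreover have "\<sigma> (Suc p - 1) \<noteq> \<sigma> (Suc p + 1)" by (rule inj) simp
        ultimately show ?thesis using 2 right[OF p] fixed s by auto
      next
        case 3
        have IH1: "int (\<sigma> (Suc p + Suc e)) = ?c + s * int (Suc e)"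
          "int (\<sigma> (Suc p - Suc e)) = ?c - s * int (Suc e)"
          using less.IH[of "Suc e"] less.prems 3 by auto
        have IH0: "int (\<sigma> (Suc p + e)) = ?c + s * int e"
          "int (\<sigma> (Suc p - e)) = ?c - s * int e"
          using less.IH[of e] less.prems 3 by auto
        have "\<bar>int (\<sigma> (Suc p + d)) - int (\<sigma> (Suc p + Suc e))\<bar> = 1"
          "\<bar>int (\<sigma> (Suc p - d)) - int (\<sigma> (Suc p - Suc e))\<bar> = 1"
          using less.prems 3 by (auto intro!: adj)
        moreover have "int (\<sigma> (Suc p + d)) \<noteq> int (\<sigma> (Suc p + e))"
          "int (\<sigma> (Suc p - d)) \<noteq> int (\<sigma> (Suc p - e))"
          using less.prems 3 by (simp_all add: inj)
        moreover have "s * int (Suc e) = s * int e + s" "s * int d = s * int e + 2 * s"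
          using 3 by (simp_all add: algebra_simps)
        ultimately show ?thesis
          unfolding IH0 IH1 using s by (elim disjE) (simp_all add: abs_if split: if_splits)
      qed
    qed
    have val: "int (\<sigma> x) = ?c + s * (int x - ?c)" if "x \<in> vertices ?n" for x
    proof (cases "Suc p \<le> x")
      case True
      then show ?thesis using main[of "x - Suc p"] that by (simp add: of_nat_diff)
    next
      case False
      then show ?thesis using main[of "Suc p - x"] that by (simp add: of_nat_diff algebra_simps)
    qed
    from s show "\<sigma> \<in> {id, reflection ?n}"
    proof
      assume "s = 1"
      then have "\<sigma> x = id x" for x using val[of x] outside[of x] by (cases "x \<in> vertices ?n") auto
      then show ?thesis by blast
    next
      assume "s = -1"
      then have "\<sigma> x = reflection ?n x" for x
        using val[of x] outside[of x]
        by (cases "x \<in> vertices ?n") (auto simp: reflection_def)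
      then show ?thesis by blast
    qed
  qed
qed

section \<open>Distances, layers and orbits\<close>

lemma graph_dist_path:
  assumes "x \<in> vertices n" and "y \<in> vertices n"
  shows "graph_dist (path_edges n) x y = nat \<bar>int x - int y\<bar>"
  unfolding graph_dist_def
proof (rule Least_equality)
  let ?R = "adj_rel (path_edges n)"
  have up: "(z, z + d) \<in> ?R ^^ d \<and> (z + d, z) \<in> ?R ^^ d" if "1 \<le> z" "z + d \<le> n" for z d
    using that
  proof (induction d)
    case (Suc d)
    then have "(z + d, z + Suc d) \<in> ?R" "(z + Suc d, z + d) \<in> ?R"
      by (auto simp: path_adj_rel)
    moreover have "(z, z + d) \<in> ?R ^^ d" "(z + d, z) \<in> ?R ^^ d" using Suc by auto
    ultimately show ?case
      by (blast intro: relpow_Suc_I relpow_Suc_I2)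
  qed auto
  show "(x, y) \<in> ?R ^^ nat \<bar>int x - int y\<bar>"
  proof (cases "x \<le> y")
    case True
    then have "nat \<bar>int x - int y\<bar> = y - x" by auto
    then show ?thesis using up[of x "y - x"] True assms by auto
  next
    case False
    then have "nat \<bar>int x - int y\<bar> = x - y" by auto
    then show ?thesis using up[of y "x - y"] False assms by auto
  qed
  show "nat \<bar>int x - int y\<bar> \<le> k" if "(x, y) \<in> ?R ^^ k" for k
  proof -
    \<comment> \<open>Each edge changes the vertex number by one, so a walk of \<open>k\<close>
      edges moves at most \<open>k\<close>.\<close>
    have "(x, z) \<in> ?R ^^ k \<Longrightarrow> \<bar>int x - int z\<bar> \<le> int k" for z
    proof (induction k arbitrary: z)
      case (Suc k)
      then obtain w where "(x, w) \<in> ?R ^^ k" "(w, z) \<in> ?R" by auto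
      then show ?case using Suc.IH[of w] by (auto simp: path_adj_rel)
    qed auto
    then show ?thesis using that by fastforce
  qed
qed

lemma dist_layer_path_middle:
  "dist_layer (Suc (2 * p)) (path_edges (Suc (2 * p))) (Suc p) k =
    {x \<in> vertices (Suc (2 * p)). nat \<bar>int x - int (Suc p)\<bar> = k}"
  unfolding dist_layer_def using graph_dist_path[of "Suc p" "Suc (2 * p)"]
  by (auto simp: abs_minus_commute)

lemma eccentricity_path_middle: "eccentricity (Suc (2 * p)) (path_edges (Suc (2 * p))) (Suc p) = p"
  unfolding eccentricity_def
proof (rule Max_eqI)
  let ?n = "Suc (2 * p)"
  show "d \<le> p" if "d \<in> graph_dist (path_edges ?n) (Suc p) ` vertices ?n" for d
    using that graph_dist_path[of "Suc p" ?n] by auto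
  have "graph_dist (path_edges ?n) (Suc p) 1 = p" using graph_dist_path[of "Suc p" ?n 1] by simp
  then show "p \<in> graph_dist (path_edges ?n) (Suc p) ` vertices ?n" by force
qed simp

text \<open>An orbit consists of \<open>x\<close> and its mirror image, which are the only vertices
  at their distance from the middle; the distances that occur fill \<open>{..p}\<close>.\<close>

lemma stabilizer_orbits_path_middle:
  fixes p :: nat
  defines "n \<equiv> Suc (2 * p)"
  shows "stabilizer_orbits n (path_edges n) (Suc p) = dist_layer n (path_edges n) (Suc p) ` {..p}"
proof -
  let ?layer = "dist_layer n (path_edges n) (Suc p)"
  have orbit: "{\<sigma> x | \<sigma>. \<sigma> \<in> aut_stabilizer n (path_edges n) (Suc p)} =
      ?layer (nat \<bar>int x - int (Suc p)\<bar>)" if "x \<in> vertices n" for x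
  proof -
    have "{\<sigma> x | \<sigma>. \<sigma> \<in> aut_stabilizer n (path_edges n) (Suc p)} = {x, reflection n x}"
      by (auto simp: n_def aut_stabilizer_path_middle intro: exI[of _ id])
    then show ?thesis
      using that by (auto simp: n_def dist_layer_path_middle reflection_def)
  qed
  have "(\<lambda>x. nat \<bar>int x - int (Suc p)\<bar>) ` vertices n = {..p}"
  proof
    show "{..p} \<subseteq> (\<lambda>x. nat \<bar>int x - int (Suc p)\<bar>) ` vertices n"
    proof
      fix k assume "k \<in> {..p}"
      then show "k \<in> (\<lambda>x. nat \<bar>int x - int (Suc p)\<bar>) ` vertices n"
        by (intro image_eqI[of _ _ "Suc p + k"]) (auto simp: n_def)
    qed
  qed (auto simp: n_def)
  then have "?layer ` {..p} = (\<lambda>x. ?layer (nat \<bar>int x - int (Suc p)\<bar>)) ` vertices n"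
    by (metis image_image)
  also have "\<dots> = stabilizer_orbits n (path_edges n) (Suc p)"
    unfolding stabilizer_orbits_def Setcompr_eq_image[symmetric] using orbit by blast
  finally show ?thesis ..
qed

lemma T2_eq_T3_path_middle:
  "T2 (Suc (2 * p)) (path_edges (Suc (2 * p))) (Suc p) =
    T3 (Suc (2 * p)) (path_edges (Suc (2 * p))) (Suc p)"
  unfolding T2_def T3_def eccentricity_path_middle stabilizer_orbits_path_middle
  by (rule arg_cong[where f = "generated_algebra _ _"]) auto

lemma generated_algebra_least:
  assumes "subring B M" and "\<And>c x. c \<in> carrier K \<Longrightarrow> x \<in> B \<Longrightarrow> c \<odot>\<^bsub>M\<^esub> x \<in> B" and "S \<subseteq> B"
  shows "generated_algebra K M S \<subseteq> B"
  unfolding generated_algebra_def by (rule Inter_lower) (use assms in blast)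


section \<open>Centrosymmetric matrices\<close>

text \<open>With indices from 0 the reflection is \<open>i \<mapsto> n - Suc i\<close>, so this is
  the commutant of its permutation matrix.\<close>

definition centrosymmetric :: "nat \<Rightarrow> complex mat set" where
  "centrosymmetric n = {M \<in> carrier_mat n n.
     \<forall>i < n. \<forall>j < n. M $$ (n - Suc i, n - Suc j) = M $$ (i, j)}"

lemma centrosymmetricI:
  assumes "M \<in> carrier_mat n n"
    and "\<And>i j. i < n \<Longrightarrow> j < n \<Longrightarrow> M $$ (n - Suc i, n - Suc j) = M $$ (i, j)"
  shows "M \<in> centrosymmetric n"
  using assms by (simp add: centrosymmetric_def)

lemma centrosymmetricD:
  assumes "M \<in> centrosymmetric n"
  shows "M \<in> carrier_mat n n"
    and "i < n \<Longrightarrow> j < n \<Longrightarrow> M $$ (n - Suc i, n - Suc j) = M $$ (i, j)"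
  using assms by (simp_all add: centrosymmetric_def)

lemma T4_path_middle:
  "T4 (Suc (2 * p)) (path_edges (Suc (2 * p))) (Suc p) = centrosymmetric (Suc (2 * p))"
proof
  let ?n = "Suc (2 * p)"
  show "T4 ?n (path_edges ?n) (Suc p) \<subseteq> centrosymmetric ?n"
  proof
    fix M assume M: "M \<in> T4 ?n (path_edges ?n) (Suc p)"
    have "M $$ (?n - Suc i, ?n - Suc j) = M $$ (i, j)" if ij: "i < ?n" "j < ?n" for i j
    proof -
      have "vertex_entry M (reflection ?n (Suc i)) (reflection ?n (Suc j)) =
          vertex_entry M (Suc i) (Suc j)"
        using M ij unfolding T4_def aut_stabilizer_path_middle by auto
      then show ?thesis using ij by (simp add: vertex_entry_def reflection_def)
    qed
    then show "M \<in> centrosymmetric ?n" using M by (intro centrosymmetricI) (auto simp: T4_def)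
  qed
  show "centrosymmetric ?n \<subseteq> T4 ?n (path_edges ?n) (Suc p)"
  proof
    fix M assume M: "M \<in> centrosymmetric ?n"
    have "vertex_entry M (reflection ?n x) (reflection ?n y) = vertex_entry M x y"
      if "x \<in> vertices ?n" "y \<in> vertices ?n" for x y
    proof -
      have "x - 1 < ?n" "y - 1 < ?n" using that by auto
      from centrosymmetricD(2)[OF M this] that show ?thesis
        by (auto simp: vertex_entry_def reflection_def)
    qed
    then show "M \<in> T4 ?n (path_edges ?n) (Suc p)"
      using centrosymmetricD(1)[OF M] by (auto simp: T4_def aut_stabilizer_path_middle)
  qed
qed

section \<open>The algebra of centrosymmetric matrices\<close>

lemma mat_mult_entry:
  fixes A B :: "'a :: semiring_0 mat"
  assumes "A \<in> carrier_mat n n" "B \<in> carrier_mat n n" "i < n" "j < n"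
  shows "(A * B) $$ (i, j) = (\<Sum>k<n. A $$ (i, k) * B $$ (k, j))"
  using assms by (simp add: scalar_prod_def lessThan_atLeast0)

lemma ring_mat_algebra: "ring (mat_algebra n)"
  by unfold_locales
    (use add_inv_exists_mat in \<open>auto simp: module_mat_simps algebra_simps Units_def\<close>)

lemma centrosymmetric_mult:
  assumes A: "A \<in> centrosymmetric n" and B: "B \<in> centrosymmetric n"
  shows "A * B \<in> centrosymmetric n"
proof (rule centrosymmetricI)
  show "A * B \<in> carrier_mat n n"
    using mult_carrier_mat[OF centrosymmetricD(1)[OF A] centrosymmetricD(1)[OF B]] .
  fix i j assume ij: "i < n" "j < n"
  have "(A * B) $$ (n - Suc i, n - Suc j) =
      (\<Sum>k<n. A $$ (n - Suc i, k) * B $$ (k, n - Suc j))"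
    using ij by (intro mat_mult_entry centrosymmetricD(1)[OF A] centrosymmetricD(1)[OF B]) auto
  \<comment> \<open>Reversing the summation index brings both factors into reflected form.\<close>
  also have "\<dots> = (\<Sum>k<n. A $$ (n - Suc i, n - Suc k) * B $$ (n - Suc k, n - Suc j))"
    by (rule sum.nat_diff_reindex[symmetric])
  also have "\<dots> = (\<Sum>k<n. A $$ (i, k) * B $$ (k, j))"
    using ij centrosymmetricD(2)[OF A] centrosymmetricD(2)[OF B] by (intro sum.cong) auto
  also have "\<dots> = (A * B) $$ (i, j)"
    by (rule mat_mult_entry[symmetric, OF centrosymmetricD(1)[OF A] centrosymmetricD(1)[OF B] ij])
  finally show "(A * B) $$ (n - Suc i, n - Suc j) = (A * B) $$ (i, j)" .
qed

lemma centrosymmetric_add: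
  "A \<in> centrosymmetric n \<Longrightarrow> B \<in> centrosymmetric n \<Longrightarrow> A + B \<in> centrosymmetric n"
  by (auto simp: centrosymmetric_def)

lemma centrosymmetric_smult:
  "A \<in> centrosymmetric n \<Longrightarrow> c \<cdot>\<^sub>m A \<in> centrosymmetric n"
  by (auto simp: centrosymmetric_def)

lemma centrosymmetric_one: "1\<^sub>m n \<in> centrosymmetric n"
  by (rule centrosymmetricI) auto

lemma mat_algebra_a_inv:
  assumes "A \<in> carrier_mat n n"
  shows "\<ominus>\<^bsub>mat_algebra n\<^esub> A = - A"
proof -
  interpret ring "mat_algebra n" by (rule ring_mat_algebra)
  show ?thesis
    by (rule minus_equality) (use assms in \<open>auto simp: module_mat_simps\<close>)
qed

lemma subring_centrosymmetric: "subring (centrosymmetric n) (mat_algebra n)"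
proof -
  interpret ring "mat_algebra n" by (rule ring_mat_algebra)
  have "- A \<in> centrosymmetric n" if "A \<in> centrosymmetric n" for A
    using that by (auto simp: centrosymmetric_def)
  then show ?thesis
    by (intro subringI)
      (auto simp: module_mat_simps mat_algebra_a_inv centrosymmetricD(1) centrosymmetric_mult
        centrosymmetric_add centrosymmetric_one)
qed

section \<open>The generators of \<open>T2\<close>\<close>

lemma adjacency_mat_path_index:
  assumes "i < n" and "j < n"
  shows "adjacency_mat n (path_edges n) $$ (i, j) = (if \<bar>int i - int j\<bar> = 1 then 1 else 0)"
  using assms by (simp add: adjacency_mat_def vertex_mat_def doubleton_path_edges_iff)

lemma adjacency_mat_path_centrosymmetric: "adjacency_mat n (path_edges n) \<in> centrosymmetric n"
proof (rule centrosymmetricI)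
  fix i j assume "i < n" "j < n"
  then show "adjacency_mat n (path_edges n) $$ (n - Suc i, n - Suc j) =
      adjacency_mat n (path_edges n) $$ (i, j)"
    by (subst (1 2) adjacency_mat_path_index) (auto simp: of_nat_diff)
qed (simp add: adjacency_mat_def vertex_mat_def)

text \<open>With indices from 0 the middle vertex is \<open>p\<close>.\<close>

definition layer_mat :: "nat \<Rightarrow> nat \<Rightarrow> complex mat" where
  "layer_mat p k = mat (Suc (2 * p)) (Suc (2 * p))
     (\<lambda>(i, j). if i = j \<and> nat \<bar>int i - int p\<bar> = k then 1 else 0)"

lemma proj_mat_path_layer:
  "proj_mat (Suc (2 * p)) (dist_layer (Suc (2 * p)) (path_edges (Suc (2 * p))) (Suc p) k) =
    layer_mat p k"
  by (rule eq_matI)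
    (auto simp: proj_mat_def vertex_mat_def layer_mat_def dist_layer_path_middle)

lemma layer_mat_centrosymmetric: "layer_mat p k \<in> centrosymmetric (Suc (2 * p))"
proof (rule centrosymmetricI)
  fix i j assume "i < Suc (2 * p)" "j < Suc (2 * p)"
  moreover have "nat \<bar>int (2 * p - i) - int p\<bar> = nat \<bar>int i - int p\<bar>" if "i < Suc (2 * p)" for i
    using that by (simp add: of_nat_diff abs_if)
  moreover have "2 * p - i = 2 * p - j \<longleftrightarrow> i = j"
    using \<open>i < _\<close> \<open>j < _\<close> by auto
  ultimately show "layer_mat p k $$ (Suc (2 * p) - Suc i, Suc (2 * p) - Suc j) =
      layer_mat p k $$ (i, j)"
    by (simp add: layer_mat_def)
qed (simp add: layer_mat_def)

lemma T2_path_middle_eq: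
  "T2 (Suc (2 * p)) (path_edges (Suc (2 * p))) (Suc p) =
    generated_algebra complex_field (mat_algebra (Suc (2 * p)))
      ({adjacency_mat (Suc (2 * p)) (path_edges (Suc (2 * p)))} \<union> layer_mat p ` {..p})"
  unfolding T2_def eccentricity_path_middle proj_mat_path_layer
  by (rule arg_cong[where f = "generated_algebra _ _"]) auto

lemma T2_path_middle_subset:
  "T2 (Suc (2 * p)) (path_edges (Suc (2 * p))) (Suc p) \<subseteq> centrosymmetric (Suc (2 * p))"
  unfolding T2_path_middle_eq
  by (rule generated_algebra_least[OF subring_centrosymmetric])
    (simp_all add: module_mat_simps centrosymmetric_smult adjacency_mat_path_centrosymmetric
      layer_mat_centrosymmetric image_subset_iff)

section \<open>Matrix units and orbital matrices\<close>

definition unit_mat :: "nat \<Rightarrow> nat \<Rightarrow> nat \<Rightarrow> complex mat" where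
  "unit_mat n i j = mat n n (\<lambda>(a, b). if a = i \<and> b = j then 1 else 0)"

lemma unit_mat_carrier [simp]: "unit_mat n i j \<in> carrier_mat n n"
  by (simp add: unit_mat_def)

lemma unit_mat_mult:
  assumes "j < n" and "k < n"
  shows "unit_mat n i j * unit_mat n k l = (if j = k then unit_mat n i l else 0\<^sub>m n n)"
proof (rule eq_matI)
  fix a b
  assume "a < dim_row (if j = k then unit_mat n i l else 0\<^sub>m n n)"
    and "b < dim_col (if j = k then unit_mat n i l else 0\<^sub>m n n)"
  then have ab: "a < n" "b < n" by (auto simp: unit_mat_def split: if_splits)
  have "(unit_mat n i j * unit_mat n k l) $$ (a, b) =
      (\<Sum>c<n. (if c = j then if a = i \<and> j = k \<and> b = l then 1 else 0 else 0))"
    unfolding mat_mult_entry[OF unit_mat_carrier unit_mat_carrier ab]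
    by (rule sum.cong) (use ab in \<open>auto simp: unit_mat_def\<close>)
  also have "\<dots> = (if j = k then unit_mat n i l else 0\<^sub>m n n) $$ (a, b)"
    using ab assms by (simp add: unit_mat_def)
  finally show "(unit_mat n i j * unit_mat n k l) $$ (a, b) =
      (if j = k then unit_mat n i l else 0\<^sub>m n n) $$ (a, b)" .
qed (auto simp: unit_mat_def)

text \<open>The sum of a matrix unit and its mirror image. When the pair is fixed by the reflection,
  its unit is counted twice.\<close>

definition orbital_mat :: "nat \<Rightarrow> nat \<Rightarrow> nat \<Rightarrow> complex mat" where
  "orbital_mat n i j = unit_mat n i j + unit_mat n (n - Suc i) (n - Suc j)"

lemma orbital_mat_carrier [simp]: "orbital_mat n i j \<in> carrier_mat n n"
  by (simp add: orbital_mat_def)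

lemma orbital_mat_reflect:
  "i < n \<Longrightarrow> j < n \<Longrightarrow> orbital_mat n (n - Suc i) (n - Suc j) = orbital_mat n i j"
  by (simp add: orbital_mat_def Suc_diff_Suc comm_add_mat[of _ n n])

text \<open>Of the four products of matrix units, the two mixed ones survive only if the reflection
  fixes \<open>j\<close>.\<close>

lemma orbital_mat_mult:
  assumes "i < n" "j < n" "k < n"
  shows "orbital_mat n i j * orbital_mat n j k =
    (if j = n - Suc j then orbital_mat n i k + orbital_mat n i (n - Suc k) else orbital_mat n i k)"
proof -
  let ?U = "unit_mat n" and ?r = "\<lambda>x. n - Suc x"
  have "orbital_mat n i j * orbital_mat n j k =
      (?U i j * ?U j k + ?U (?r i) (?r j) * ?U j k) +
      (?U i j * ?U (?r j) (?r k) + ?U (?r i) (?r j) * ?U (?r j) (?r k))"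
    unfolding orbital_mat_def
    by (simp add: add_mult_distrib_mat[of _ n n _ _ n] mult_add_distrib_mat[of _ n n _ n])
  also have "\<dots> =
      (?U i k + (if j = ?r j then ?U (?r i) k else 0\<^sub>m n n)) +
      ((if j = ?r j then ?U i (?r k) else 0\<^sub>m n n) + ?U (?r i) (?r k))"
    using assms by (simp add: unit_mat_mult)
  finally have eq: "orbital_mat n i j * orbital_mat n j k = \<dots>" .
  have k: "n - Suc (?r k) = k" using assms by simp
  show ?thesis
  proof (cases "j = ?r j")
    case True
    show ?thesis
      unfolding eq if_P[OF True] unfolding orbital_mat_def k
      by (rule eq_matI) (simp_all add: unit_mat_def)
  next
    case False
    show ?thesis
      unfolding eq if_not_P[OF False] unfolding orbital_mat_def
      by (rule eq_matI) (simp_all add: unit_mat_def)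
  qed
qed

section \<open>Orbital matrices from the generators\<close>

lemma mat_conjugate_layer_index:
  assumes "M \<in> carrier_mat (Suc (2 * p)) (Suc (2 * p))" "a < Suc (2 * p)" "b < Suc (2 * p)"
  shows "(layer_mat p k * M * layer_mat p l) $$ (a, b) =
    (if nat \<bar>int a - int p\<bar> = k \<and> nat \<bar>int b - int p\<bar> = l then M $$ (a, b) else 0)"
proof -
  let ?n = "Suc (2 * p)"
  have L: "layer_mat p k \<in> carrier_mat ?n ?n" for k by (simp add: layer_mat_def)
  \<comment> \<open>The projections are diagonal, so each product sum has at most one nonzero
    term.\<close>
  have left: "(layer_mat p k * M) $$ (a, c) =
      (if nat \<bar>int a - int p\<bar> = k then M $$ (a, c) else 0)" if "c < ?n" for c
  proof -
    have "(layer_mat p k * M) $$ (a, c) =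
        (\<Sum>d<?n. if d = a then if nat \<bar>int a - int p\<bar> = k then M $$ (a, c) else 0 else 0)"
      unfolding mat_mult_entry[OF L assms(1,2) that]
      by (rule sum.cong) (use assms that in \<open>auto simp: layer_mat_def\<close>)
    then show ?thesis using assms by simp
  qed
  have "(layer_mat p k * M * layer_mat p l) $$ (a, b) =
      (\<Sum>d<?n. (layer_mat p k * M) $$ (a, d) * layer_mat p l $$ (d, b))"
    by (rule mat_mult_entry[OF mult_carrier_mat[OF L assms(1)] L assms(2,3)])
  also have "\<dots> = (\<Sum>d<?n. if d = b then
      if nat \<bar>int a - int p\<bar> = k \<and> nat \<bar>int b - int p\<bar> = l then M $$ (a, b) else 0 else 0)"
    by (intro sum.cong) (use assms left in \<open>auto simp: layer_mat_def\<close>)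
  finally show ?thesis using assms by simp
qed

text \<open>Between the consecutive layers of \<open>i\<close> and \<open>Suc i\<close> the path has
  only the edge joining these two vertices and its mirror image. The unordered condition on
  \<open>j\<close> and \<open>k\<close> covers both directions.\<close>

lemma orbital_mat_adjacent:
  assumes "p \<le> i" and "i < 2 * p" and "{j, k} = {i, Suc i}"
  shows "orbital_mat (Suc (2 * p)) j k = layer_mat p (j - p) *
    adjacency_mat (Suc (2 * p)) (path_edges (Suc (2 * p))) * layer_mat p (k - p)"
proof (rule eq_matI)
  let ?n = "Suc (2 * p)" let ?A = "adjacency_mat ?n (path_edges ?n)"
  have A: "?A \<in> carrier_mat ?n ?n" by (simp add: adjacency_mat_def vertex_mat_def)
  fix a b
  assume "a < dim_row (layer_mat p (j - p) * ?A * layer_mat p (k - p))"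
    and "b < dim_col (layer_mat p (j - p) * ?A * layer_mat p (k - p))"
  then have ab: "a < ?n" "b < ?n" by (auto simp: layer_mat_def)
  have jk: "j = i \<and> k = Suc i \<or> j = Suc i \<and> k = i"
    using assms(3) by (auto simp: doubleton_eq_iff)
  have abs_eq: "nat \<bar>int c - int p\<bar> = d - p \<longleftrightarrow> c = d \<or> c = 2 * p - d"
    if "p \<le> d" "d \<le> 2 * p" "c < ?n" for c d
    using that by (auto simp: of_nat_diff)
  have "(layer_mat p (j - p) * ?A * layer_mat p (k - p)) $$ (a, b) =
      (if (a = j \<or> a = 2 * p - j) \<and> (b = k \<or> b = 2 * p - k) \<and> \<bar>int a - int b\<bar> = 1
       then 1 else 0)"
  proof -
    have "p \<le> j" "j \<le> 2 * p" "p \<le> k" "k \<le> 2 * p" using assms(1,2) jk by auto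
    then show ?thesis
      unfolding mat_conjugate_layer_index[OF A ab] adjacency_mat_path_index[OF ab]
        abs_eq[OF \<open>p \<le> j\<close> \<open>j \<le> 2 * p\<close> ab(1)] abs_eq[OF \<open>p \<le> k\<close> \<open>k \<le> 2 * p\<close> ab(2)]
      by (simp only: if_if_eq_conj if_bool_eq_conj split: if_split) blast
  qed
  also have "\<dots> = (if a = j \<and> b = k \<or> a = 2 * p - j \<and> b = 2 * p - k then 1 else 0)"
  proof -
    \<comment> \<open>A pair such as \<open>(j, 2 * p - k)\<close> has a gap of at least 3 unless
      \<open>i = p\<close>; then one of \<open>j\<close>, \<open>k\<close> is its own mirror image,
      and the pair is already listed on the right.\<close>
    have "((a = j \<or> a = 2 * p - j) \<and> (b = k \<or> b = 2 * p - k) \<and> \<bar>int a - int b\<bar> = 1) \<longleftrightarrow>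
        (a = j \<and> b = k \<or> a = 2 * p - j \<and> b = 2 * p - k)"
      using jk
    proof
      assume "j = i \<and> k = Suc i"
      then show ?thesis using assms(1,2) by (auto simp: of_nat_diff)
    next
      assume "j = Suc i \<and> k = i"
      then show ?thesis using assms(1,2) by (auto simp: of_nat_diff)
    qed
    then show ?thesis by simp
  qed
  \<comment> \<open>The two alternatives exclude each other: if both held, \<open>j\<close> and
    \<open>k\<close> would both be \<open>p\<close>.\<close>
  also have "\<dots> = (if a = j \<and> b = k then 1 else 0) +
      (if a = 2 * p - j \<and> b = 2 * p - k then 1 else 0)"
    using assms(1,2) jk by auto
  also have "\<dots> = orbital_mat ?n j k $$ (a, b)"
    using ab by (simp add: orbital_mat_def unit_mat_def)
  finally show "orbital_mat ?n j k $$ (a, b) =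
      (layer_mat p (j - p) * ?A * layer_mat p (k - p)) $$ (a, b)" ..
qed (auto simp: orbital_mat_def unit_mat_def layer_mat_def)

text \<open>The factor 2 arises at the middle, where both summands of the orbital matrix
  coincide.\<close>

lemma orbital_mat_diagonal:
  assumes "p \<le> i" and "i \<le> 2 * p"
  shows "orbital_mat (Suc (2 * p)) i i = (if i = p then 2 else 1) \<cdot>\<^sub>m layer_mat p (i - p)"
proof (rule eq_matI)
  fix a b
  assume "a < dim_row ((if i = p then 2 else 1) \<cdot>\<^sub>m layer_mat p (i - p))"
    and "b < dim_col ((if i = p then 2 else 1) \<cdot>\<^sub>m layer_mat p (i - p))"
  then have ab: "a < Suc (2 * p)" "b < Suc (2 * p)" by (auto simp: layer_mat_def)
  have "nat \<bar>int a - int p\<bar> = i - p \<longleftrightarrow> a = i \<or> a = 2 * p - i"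
    using ab assms by (auto simp: of_nat_diff)
  then show "orbital_mat (Suc (2 * p)) i i $$ (a, b) =
      ((if i = p then 2 else 1) \<cdot>\<^sub>m layer_mat p (i - p)) $$ (a, b)"
    using ab assms by (auto simp: orbital_mat_def unit_mat_def layer_mat_def)
qed (auto simp: orbital_mat_def unit_mat_def layer_mat_def)

text \<open>The subalgebra \<open>B\<close> is arbitrary because the generated algebra is the
  intersection of all subalgebras containing the generators.\<close>

lemma orbital_mat_mem_subalgebra:
  assumes B: "subring B (mat_algebra (Suc (2 * p)))"
    and smult: "\<And>c M. M \<in> B \<Longrightarrow> c \<cdot>\<^sub>m M \<in> B"
    and adj: "adjacency_mat (Suc (2 * p)) (path_edges (Suc (2 * p))) \<in> B"
    and layers: "\<And>k. k \<le> p \<Longrightarrow> layer_mat p k \<in> B"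
    and ij: "i < Suc (2 * p)" "j < Suc (2 * p)"
  shows "orbital_mat (Suc (2 * p)) i j \<in> B"
proof -
  let ?n = "Suc (2 * p)" and ?C = "orbital_mat (Suc (2 * p))"
  note mult = subringE(6)[OF B, unfolded module_mat_simps]
  note add = subringE(7)[OF B, unfolded module_mat_simps]
  have diag: "?C i i \<in> B" if "p \<le> i" "i \<le> 2 * p" for i
    unfolding orbital_mat_diagonal[OF that] using that by (intro smult layers) auto
  have adjacent: "?C i (Suc i) \<in> B" "?C (Suc i) i \<in> B" if "p \<le> i" "i < 2 * p" for i
    using orbital_mat_adjacent[OF that, of i "Suc i"] orbital_mat_adjacent[OF that, of "Suc i" i] that
    by (auto simp: insert_commute intro!: mult layers adj)
  \<comment> \<open>The condition \<open>p < j\<close> means that \<open>j\<close> is not fixed by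
    the reflection, so the product is a single orbital matrix.\<close>
  have step: "?C i k \<in> B" if "?C i j \<in> B" "?C j k \<in> B" "i < ?n" "p < j" "j < ?n" "k < ?n" for i j k
    using mult[OF that(1,2)] orbital_mat_mult[of i ?n j k] that by (auto split: if_splits)
  have chain: "?C i (i + d) \<in> B \<and> ?C (i + d) i \<in> B" if "p \<le> i" "i + d \<le> 2 * p" for i d
    using that
  proof (induction d)
    case 0
    then show ?case using diag by simp
  next
    case (Suc d)
    \<comment> \<open>For \<open>d = 0\<close> the intermediate vertex \<open>i + d\<close> may be
      the middle, where \<open>step\<close> does not apply; that case is a single edge.\<close>
    show ?case
    proof (cases "d = 0")
      case True
      then show ?thesis using adjacent[of i] Suc.prems by simp
    next
      case False
      then show ?thesis
        using Suc adjacent[of "i + d"] step[of i "i + d" "Suc (i + d)"]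
          step[of "Suc (i + d)" "i + d" i] by auto
    qed
  qed
  have same_side: "?C i j \<in> B" if "p \<le> i" "i < ?n" "p \<le> j" "j < ?n" for i j
  proof (cases "i \<le> j")
    case True
    then show ?thesis using chain[of i "j - i"] that by auto
  next
    case False
    then show ?thesis using chain[of j "i - j"] that by auto
  qed
  \<comment> \<open>Passing through the fixed vertex \<open>p\<close> of the reflection is the only way to change sides.\<close>
  have lower: "?C i j \<in> B" if "p \<le> i" "i < ?n" "j < ?n" for i j
  proof (cases "p \<le> j")
    case True
    then show ?thesis using same_side that by blast
  next
    case False
    \<comment> \<open>The mirror image of \<open>j\<close> lies on the side of \<open>i\<close>, so
      \<open>?C i k\<close> is already in \<open>B\<close> and can be subtracted from the product
      through \<open>p\<close>.\<close>
    define k where "k = 2 * p - j"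
    have k: "p \<le> k" "k < ?n" "?n - Suc k = j" using False by (auto simp: k_def)
    have "?C i p * ?C p k = ?C i k + ?C i j"
      using orbital_mat_mult[of i ?n p k] that k by auto
    then have "?C i j = ?C i p * ?C p k + (-1) \<cdot>\<^sub>m ?C i k"
      by (intro eq_matI) (auto simp: orbital_mat_def unit_mat_def)
    then show ?thesis
      using that k by (auto intro!: add mult smult same_side)
  qed
  show ?thesis
  proof (cases "p \<le> i")
    case True
    then show ?thesis using lower ij by blast
  next
    case False
    \<comment> \<open>Reflecting both indices fixes the orbital matrix and moves the row to the side
      already treated.\<close>
    then have "?C (?n - Suc i) (?n - Suc j) \<in> B" by (intro lower) auto
    then show ?thesis using orbital_mat_reflect[OF ij] by simp
  qed
qed

text \<open>\<open>M\<close> is the sum of \<open>M $$ (i, j) / 2\<close> times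
  \<open>orbital_mat n i j\<close> over all pairs. The half compensates for each matrix unit
  occurring twice, and summing over all pairs avoids choosing orbit representatives.\<close>

lemma centrosymmetric_subset_subalgebra:
  assumes B: "subring B (mat_algebra n)"
    and smult: "\<And>c M. M \<in> B \<Longrightarrow> c \<cdot>\<^sub>m M \<in> B"
    and orbital: "\<And>i j. i < n \<Longrightarrow> j < n \<Longrightarrow> orbital_mat n i j \<in> B"
  shows "centrosymmetric n \<subseteq> B"
proof
  fix M assume M: "M \<in> centrosymmetric n"
  note add = subringE(7)[OF B, unfolded module_mat_simps]
  let ?comb = "\<lambda>S. mat n n (\<lambda>(a, b). \<Sum>(i, j)\<in>S. M $$ (i, j) / 2 * orbital_mat n i j $$ (a, b))"
  \<comment> \<open>The sum is built up over finite index sets because \<open>B\<close> is closed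
    under binary sums.\<close>
  have "?comb S \<in> B" if "finite S" "S \<subseteq> {..<n} \<times> {..<n}" for S
    using that
  proof (induction S rule: finite_induct)
    case empty
    have "?comb {} = 0\<^sub>m n n" by (rule eq_matI) auto
    then show ?case using subringE(2)[OF B] by (simp only: module_mat_simps)
  next
    case (insert x S)
    obtain i j where x: "x = (i, j)" by (cases x)
    have comb: "?comb (insert x S) = (M $$ (i, j) / 2) \<cdot>\<^sub>m orbital_mat n i j + ?comb S"
      using insert.hyps x by (intro eq_matI) (auto simp: orbital_mat_def unit_mat_def)
    show ?case
      unfolding comb by (intro add smult orbital insert.IH) (use insert.prems x in auto)
  qed
  then have "?comb ({..<n} \<times> {..<n}) \<in> B" by simp
  moreover have "?comb ({..<n} \<times> {..<n}) = M"
  proof (rule eq_matI)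
    show "dim_row (?comb ({..<n} \<times> {..<n})) = dim_row M"
      "dim_col (?comb ({..<n} \<times> {..<n})) = dim_col M"
      using centrosymmetricD(1)[OF M] by auto
    fix a b assume "a < dim_row M" "b < dim_col M"
    then have ab: "a < n" "b < n" using centrosymmetricD(1)[OF M] by auto
    have orb: "orbital_mat n i j $$ (a, b) = (if (i, j) = (a, b) then 1 else 0) +
        (if (i, j) = (n - Suc a, n - Suc b) then 1 else 0)" if "i < n" "j < n" for i j
    proof -
      have "a = n - Suc i \<longleftrightarrow> i = n - Suc a" "b = n - Suc j \<longleftrightarrow> j = n - Suc b"
        using that ab by auto
      then show ?thesis using ab by (auto simp: orbital_mat_def unit_mat_def)
    qed
    have "?comb ({..<n} \<times> {..<n}) $$ (a, b) =
        (\<Sum>x\<in>{..<n} \<times> {..<n}. (if x = (a, b) then M $$ (a, b) / 2 else 0) +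
          (if x = (n - Suc a, n - Suc b) then M $$ (n - Suc a, n - Suc b) / 2 else 0))"
      unfolding index_mat(1)[OF ab] case_prod_conv
    proof (rule sum.cong)
      fix x assume "x \<in> {..<n} \<times> {..<n}"
      then obtain i j where x: "x = (i, j)" "i < n" "j < n" by blast
      show "(case x of (i, j) \<Rightarrow> M $$ (i, j) / 2 * orbital_mat n i j $$ (a, b)) =
          (if x = (a, b) then M $$ (a, b) / 2 else 0) +
          (if x = (n - Suc a, n - Suc b) then M $$ (n - Suc a, n - Suc b) / 2 else 0)"
        unfolding x(1) case_prod_conv orb[OF x(2,3)] by (auto simp: distrib_left)
    qed simp
    also have "\<dots> = M $$ (a, b) / 2 + M $$ (n - Suc a, n - Suc b) / 2"
      using ab by (simp add: sum.distrib)
    also have "\<dots> = M $$ (a, b)" using centrosymmetricD(2)[OF M ab] by simp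
    finally show "?comb ({..<n} \<times> {..<n}) $$ (a, b) = M $$ (a, b)" .
  qed
  ultimately show "M \<in> B" by simp
qed

lemma T2_path_middle:
  "T2 (Suc (2 * p)) (path_edges (Suc (2 * p))) (Suc p) = centrosymmetric (Suc (2 * p))"
proof
  have "centrosymmetric (Suc (2 * p)) \<subseteq> B"
    if "subring B (mat_algebra (Suc (2 * p)))"
      "\<forall>c \<in> carrier complex_field. \<forall>x \<in> B. c \<odot>\<^bsub>mat_algebra (Suc (2 * p))\<^esub> x \<in> B"
      "{adjacency_mat (Suc (2 * p)) (path_edges (Suc (2 * p)))} \<union> layer_mat p ` {..p} \<subseteq> B" for B
    using that
    by (intro centrosymmetric_subset_subalgebra orbital_mat_mem_subalgebra)
      (auto simp: module_mat_simps)
  then show "centrosymmetric (Suc (2 * p)) \<subseteq>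
      T2 (Suc (2 * p)) (path_edges (Suc (2 * p))) (Suc p)"
    unfolding T2_path_middle_eq generated_algebra_def by blast
qed (rule T2_path_middle_subset)

section \<open>The decomposition into symmetric and skew parts\<close>

text \<open>A centrosymmetric matrix preserves the span of \<open>e\<^sub>p\<close> and the vectors
  \<open>e\<^bsub>p+k\<^esub> + e\<^bsub>p-k\<^esub>\<close> and the span of the vectors \<open>e\<^bsub>p+k\<^esub> - e\<^bsub>p-k\<^esub>\<close>. The two parts are its
  matrices with respect to these bases.\<close>

definition symmetric_part :: "nat \<Rightarrow> complex mat \<Rightarrow> complex mat" where
  "symmetric_part p M = mat (Suc p) (Suc p) (\<lambda>(i, j).
     if j = 0 then M $$ (p + i, p) else M $$ (p + i, p + j) + M $$ (p + i, p - j))"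

definition skew_part :: "nat \<Rightarrow> complex mat \<Rightarrow> complex mat" where
  "skew_part p M = mat p p (\<lambda>(i, j).
     M $$ (p + Suc i, p + Suc j) - M $$ (p + Suc i, p - Suc j))"

text \<open>The inverse of taking both parts: half sums and half differences give the rows from the
  middle on, and reflection gives the earlier rows. Skew indices are shifted by one because the skew
  basis starts at distance 1; skew vectors vanish at the middle, hence the 0 for
  \<open>i = 0\<close>.\<close>

definition join_parts :: "nat \<Rightarrow> complex mat \<times> complex mat \<Rightarrow> complex mat" where
  "join_parts p PQ = mat (Suc (2 * p)) (Suc (2 * p)) (\<lambda>(x, y).
     let row = (\<lambda>i y. if y = p then fst PQ $$ (i, 0)
       else if p < y then
         (fst PQ $$ (i, y - p) + (if i = 0 then 0 else snd PQ $$ (i - 1, y - p - 1))) / 2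
       else (fst PQ $$ (i, p - y) - (if i = 0 then 0 else snd PQ $$ (i - 1, p - y - 1))) / 2)
     in if x < p then row (p - x) (2 * p - y) else row (x - p) y)"

lemma centrosymmetric_around_middle:
  assumes "M \<in> centrosymmetric (Suc (2 * p))" and "a \<le> p" and "b \<le> p"
  shows "M $$ (p - a, p - b) = M $$ (p + a, p + b)"
    and "M $$ (p - a, p + b) = M $$ (p + a, p - b)"
    and "M $$ (p - a, p) = M $$ (p + a, p)"
    and "M $$ (p, p - b) = M $$ (p, p + b)"
  using centrosymmetricD(2)[OF assms(1), of "p + a" "p + b"]
    centrosymmetricD(2)[OF assms(1), of "p + a" "p - b"]
    centrosymmetricD(2)[OF assms(1), of "p + a" p]
    centrosymmetricD(2)[OF assms(1), of p "p + b"] assms(2,3)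
  by (simp_all add: mult_2)

text \<open>Grouping indices by distance from the middle turns the sum in a matrix product into a
  sum over the basis vectors of the parts.\<close>

lemma sum_around_middle:
  fixes f :: "nat \<Rightarrow> 'a :: comm_monoid_add"
  shows "(\<Sum>k<Suc (2 * p). f k) = f p + (\<Sum>k<p. f (p + Suc k) + f (p - Suc k))"
proof -
  have "(\<Sum>k<p + q. f k) = (\<Sum>k<p. f k) + (\<Sum>k<q. f (p + k))" for q
    by (induction q) (simp_all add: ac_simps)
  from this[of "Suc p"] have "(\<Sum>k<Suc (2 * p). f k) = (\<Sum>k<p. f k) + (\<Sum>k<Suc p. f (p + k))"
    by (simp add: mult_2)
  also have "(\<Sum>k<p. f k) = (\<Sum>k<p. f (p - Suc k))" by (rule sum.nat_diff_reindex[symmetric])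
  finally show ?thesis by (simp add: sum.lessThan_Suc_shift sum.distrib ac_simps del: sum.lessThan_Suc)
qed

text \<open>\<open>N\<close> maps symmetric vectors to symmetric ones: the column combinations in
  its symmetric part agree at \<open>p + k\<close> and \<open>p - k\<close>, so the matching entries
  of \<open>M\<close> add up to an entry of its symmetric part.\<close>

lemma symmetric_part_mult:
  assumes M: "M \<in> centrosymmetric (Suc (2 * p))" and N: "N \<in> centrosymmetric (Suc (2 * p))"
  shows "symmetric_part p (M * N) = symmetric_part p M * symmetric_part p N"
proof (rule eq_matI)
  fix i j
  assume "i < dim_row (symmetric_part p M * symmetric_part p N)"
    and "j < dim_col (symmetric_part p M * symmetric_part p N)"
  then have ij: "i < Suc p" "j < Suc p" by (auto simp: symmetric_part_def)
  note entry = mat_mult_entry[OF centrosymmetricD(1)[OF M] centrosymmetricD(1)[OF N],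
      unfolded sum_around_middle]
  note mid = centrosymmetric_around_middle[OF N]
  have "(symmetric_part p M * symmetric_part p N) $$ (i, j) =
      (\<Sum>k<Suc p. symmetric_part p M $$ (i, k) * symmetric_part p N $$ (k, j))"
    by (rule mat_mult_entry) (use ij in \<open>auto simp: symmetric_part_def\<close>)
  also have "\<dots> = symmetric_part p (M * N) $$ (i, j)"
  \<comment> \<open>Column 0 belongs to the single basis vector at the middle, the other columns to
    pairs.\<close>
  proof (cases "j = 0")
    case True
    then show ?thesis
      using ij entry[of "p + i" p] mid(3)[of _ 0]
      by (simp add: symmetric_part_def sum.lessThan_Suc_shift algebra_simps sum.distrib
          del: sum.lessThan_Suc)
  next
    case False
    then show ?thesis
      using ij entry[of "p + i" "p + j"] entry[of "p + i" "p - j"] mid(1,2)[of _ j]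
      by (simp add: symmetric_part_def sum.lessThan_Suc_shift algebra_simps
          sum.distrib del: sum.lessThan_Suc)
  qed
  finally show "symmetric_part p (M * N) $$ (i, j) =
      (symmetric_part p M * symmetric_part p N) $$ (i, j)" ..
qed (auto simp: symmetric_part_def)

lemma skew_part_mult:
  assumes M: "M \<in> centrosymmetric (Suc (2 * p))" and N: "N \<in> centrosymmetric (Suc (2 * p))"
  shows "skew_part p (M * N) = skew_part p M * skew_part p N"
proof (rule eq_matI)
  fix i j
  assume "i < dim_row (skew_part p M * skew_part p N)"
    and "j < dim_col (skew_part p M * skew_part p N)"
  then have ij: "i < p" "j < p" by (auto simp: skew_part_def)
  note entry = mat_mult_entry[OF centrosymmetricD(1)[OF M] centrosymmetricD(1)[OF N],
      unfolded sum_around_middle]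
  note mid = centrosymmetric_around_middle[OF N]
  have "(skew_part p M * skew_part p N) $$ (i, j) =
      (\<Sum>k<p. skew_part p M $$ (i, k) * skew_part p N $$ (k, j))"
    by (rule mat_mult_entry) (use ij in \<open>auto simp: skew_part_def\<close>)
  also have "\<dots> = skew_part p (M * N) $$ (i, j)"
  proof -
    have "p + Suc i < Suc (2 * p)" "p + Suc j < Suc (2 * p)" "p - Suc j < Suc (2 * p)"
      using ij by auto
    \<comment> \<open>By \<open>mid(4)\<close> the two columns of \<open>N\<close> agree in the
      middle row, so the middle term of the sum cancels.\<close>
    then show ?thesis
      using ij entry[of "p + Suc i" "p + Suc j"] entry[of "p + Suc i" "p - Suc j"]
        mid(1,2)[of _ "Suc j"] mid(4)[of 0 "Suc j"]
      by (simp add: skew_part_def algebra_simps sum.distrib sum_subtractf del: sum.lessThan_Suc)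
  qed
  finally show "skew_part p (M * N) $$ (i, j) = (skew_part p M * skew_part p N) $$ (i, j)" ..
qed (auto simp: skew_part_def)

lemma join_parts_centrosymmetric: "join_parts p PQ \<in> centrosymmetric (Suc (2 * p))"
proof (rule centrosymmetricI)
  fix i j assume "i < Suc (2 * p)" "j < Suc (2 * p)"
  then show "join_parts p PQ $$ (Suc (2 * p) - Suc i, Suc (2 * p) - Suc j) =
      join_parts p PQ $$ (i, j)"
    by (cases i p rule: linorder_cases; cases j p rule: linorder_cases)
      (auto simp: join_parts_def Let_def)
qed (simp add: join_parts_def)

lemma symmetric_part_join:
  assumes "fst PQ \<in> carrier_mat (Suc p) (Suc p)"
  shows "symmetric_part p (join_parts p PQ) = fst PQ"
  by (rule eq_matI) (use assms in \<open>auto simp: symmetric_part_def join_parts_def Let_def field_simps\<close>)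

lemma skew_part_join:
  assumes "snd PQ \<in> carrier_mat p p"
  shows "skew_part p (join_parts p PQ) = snd PQ"
  by (rule eq_matI) (use assms in \<open>auto simp: skew_part_def join_parts_def Let_def field_simps\<close>)

lemma join_parts_of_parts:
  assumes M: "M \<in> centrosymmetric (Suc (2 * p))"
  shows "join_parts p (symmetric_part p M, skew_part p M) = M"
proof (rule eq_matI)
  let ?n = "Suc (2 * p)" and ?J = "join_parts p (symmetric_part p M, skew_part p M)"
  show "dim_row ?J = dim_row M" "dim_col ?J = dim_col M"
    using centrosymmetricD(1)[OF M] by (auto simp: join_parts_def)
  \<comment> \<open>Rows from the middle on suffice, since both matrices are
    centrosymmetric.\<close>
  have upper: "?J $$ (p + i, y) = M $$ (p + i, y)" if "i \<le> p" "y < ?n" for i y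
  proof (cases y p rule: linorder_cases)
    case less
    \<comment> \<open>This \<open>k\<close> is the column index in the skew part.\<close>
    define k where "k = p - Suc y"
    have "y = p - Suc k" "k < p" using less by (auto simp: k_def)
    then show ?thesis
      using that centrosymmetric_around_middle(4)[OF M, of 0 "Suc k"]
      by (cases i) (auto simp: join_parts_def symmetric_part_def skew_part_def Let_def)
  next
    case equal
    then show ?thesis using that by (simp add: join_parts_def symmetric_part_def)
  next
    case greater
    then show ?thesis
      using that centrosymmetric_around_middle(4)[OF M, of 0 "y - p"]
      by (cases i) (auto simp: join_parts_def symmetric_part_def skew_part_def Let_def)
  qed
  fix x y assume "x < dim_row M" "y < dim_col M"
  then have xy: "x < ?n" "y < ?n" using centrosymmetricD(1)[OF M] by auto
  show "?J $$ (x, y) = M $$ (x, y)"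
  proof (cases "p \<le> x")
    case True
    then show ?thesis using upper[of "x - p" y] xy by simp
  next
    case False
    then have "?J $$ (?n - Suc x, ?n - Suc y) = M $$ (?n - Suc x, ?n - Suc y)"
      using upper[of "p - x" "?n - Suc y"] xy by (simp add: mult_2)
    then show ?thesis
      using centrosymmetricD(2)[OF M xy] centrosymmetricD(2)[OF join_parts_centrosymmetric xy]
      by metis
  qed
qed

lemma centrosymmetric_algebra_isomorphic:
  "algebra_isomorphic complex_field (mat_subalgebra (Suc (2 * p)) (centrosymmetric (Suc (2 * p))))
    (algebra_direct_sum (mat_algebra (Suc p)) (mat_algebra p))"
proof -
  let ?n = "Suc (2 * p)"
  let ?M = "mat_subalgebra ?n (centrosymmetric ?n)"
  let ?S = "algebra_direct_sum (mat_algebra (Suc p)) (mat_algebra p)"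
  let ?h = "\<lambda>M. (symmetric_part p M, skew_part p M)"
  have closed: "?h M \<in> carrier ?S" for M
    by (simp add: algebra_direct_sum_simps module_mat_simps symmetric_part_def skew_part_def)
  have add: "?h (M + N) = ?h M \<oplus>\<^bsub>?S\<^esub> ?h N"
    if "M \<in> centrosymmetric ?n" "N \<in> centrosymmetric ?n" for M N
    using centrosymmetricD(1)[OF that(1)] centrosymmetricD(1)[OF that(2)]
    by (auto simp: algebra_direct_sum_simps module_mat_simps symmetric_part_def skew_part_def
        intro!: eq_matI)
  have smult: "?h (c \<cdot>\<^sub>m M) = c \<odot>\<^bsub>?S\<^esub> ?h M" if "M \<in> centrosymmetric ?n" for c M
    using centrosymmetricD(1)[OF that]
    by (auto simp: algebra_direct_sum_simps module_mat_simps symmetric_part_def skew_part_def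
        algebra_simps intro!: eq_matI)
  have one: "?h (1\<^sub>m ?n) = \<one>\<^bsub>?S\<^esub>"
    by (auto simp: algebra_direct_sum_simps module_mat_simps symmetric_part_def skew_part_def
        intro!: eq_matI)
  have "?h \<in> Ring.ring_hom ?M ?S"
    by (rule ring_hom_memI)
      (use closed add one in \<open>auto simp: module_mat_simps algebra_direct_sum_simps
        symmetric_part_mult skew_part_mult\<close>)
  moreover have "bij_betw ?h (carrier ?M) (carrier ?S)"
    by (rule bij_betwI[where g = "join_parts p"])
      (use closed in \<open>auto simp: algebra_direct_sum_simps module_mat_simps join_parts_of_parts
        join_parts_centrosymmetric symmetric_part_join skew_part_join\<close>)
  moreover have "?h \<in> LinearCombinations.module_hom complex_field ?M ?S"
    unfolding LinearCombinations.module_hom_def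
    using closed add smult by (auto simp: module_mat_simps)
  ultimately show ?thesis
    unfolding algebra_isomorphic_def ring_iso_def by blast
qed

section \<open>Dimension\<close>

lemma vectorspace_centrosymmetric:
  "vectorspace complex_field (mat_subalgebra n (centrosymmetric n))"
proof -
  interpret matrix_vs n n "TYPE(complex)" .
  have "submodule complex_field (centrosymmetric n) (mat_algebra n)"
  proof
    show "\<zero>\<^bsub>mat_algebra n\<^esub> \<in> centrosymmetric n"
      using subringE(2)[OF subring_centrosymmetric] .
  qed (auto simp: module_mat_simps centrosymmetricD(1) centrosymmetric_add centrosymmetric_smult)
  then show ?thesis
    by (intro subspace_is_vs VectorSpace.subspace.intro matrix_vs)
qed

text \<open>The entries are free on one representative of each reflection orbit of index pairs and
  determined elsewhere. Hence \<open>T\<close>, which copies each coordinate to a whole orbit, is a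
  linear bijection from the vectors of length \<open>N\<close>.\<close>

lemma dim_centrosymmetric:
  assumes "0 < n"
  shows "mat_dim n (centrosymmetric n) = (n\<^sup>2 + 1) div 2"
proof -
  define N where "N = (n\<^sup>2 + 1) div 2"
  \<comment> \<open>In row-major order the reflection is \<open>t \<mapsto> n\<^sup>2 - 1 - t\<close>, and \<open>{..<N}\<close> meets each of its orbits
    exactly once.\<close>
  define code where "code i j = min (i * n + j) (n\<^sup>2 - 1 - (i * n + j))" for i j
  define T where "T v = mat n n (\<lambda>(i, j). v $ code i j)" for v :: "complex vec"
  have bound: "i * n + j < n\<^sup>2" if "i < n" "j < n" for i j
  proof -
    have "i * n + j < Suc i * n" using that by simp
    also have "\<dots> \<le> n * n" using that by (intro mult_le_mono1) simp
    finally show ?thesis by (simp add: power2_eq_square)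
  qed
  have code_less: "code i j < N" if "i < n" "j < n" for i j
    using bound[OF that] unfolding code_def N_def by linarith
  have reflect: "(n - Suc i) * n + (n - Suc j) = n\<^sup>2 - 1 - (i * n + j)" if "i < n" "j < n" for i j
  proof -
    have "(n - Suc i) * n + i * n = (n - 1) * n" using that by (simp flip: add_mult_distrib)
    moreover have "(n - 1) * n + n = n\<^sup>2"
      using that by (simp add: power2_eq_square diff_mult_distrib)
    ultimately show ?thesis using that by linarith
  qed
  have code_refl: "code (n - Suc i) (n - Suc j) = code i j" if "i < n" "j < n" for i j
    using reflect[OF that] bound[OF that] unfolding code_def by auto
  have code_low: "t div n < n" "t mod n < n" "code (t div n) (t mod n) = t" if "t < N" for t
  proof -
    \<comment> \<open>Equivalently \<open>t \<le> n\<^sup>2 - 1 - t\<close>, so \<open>t\<close> is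
      the smaller element of its orbit and its own code.\<close>
    have "2 * t + 1 \<le> n\<^sup>2" using that unfolding N_def by linarith
    then show "t div n < n" "code (t div n) (t mod n) = t"
      by (auto simp: code_def less_mult_imp_div_less power2_eq_square)
    show "t mod n < n" using assms by simp
  qed
  interpret U: vec_space "TYPE(complex)" N .
  interpret W: vectorspace complex_field "mat_subalgebra n (centrosymmetric n)"
    by (rule vectorspace_centrosymmetric)
  have T_cs: "T v \<in> centrosymmetric n" for v
    by (rule centrosymmetricI) (auto simp: T_def code_refl)
  have hom: "T \<in> LinearCombinations.module_hom complex_field (module_vec TYPE(complex) N)
      (mat_subalgebra n (centrosymmetric n))"
    unfolding LinearCombinations.module_hom_def using code_less T_cs
    by (auto simp: module_mat_simps module_vec_simps T_def intro!: eq_matI)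
  interpret linear_map complex_field "module_vec TYPE(complex) N"
    "mat_subalgebra n (centrosymmetric n)" T
    by unfold_locales (rule hom)
  have inj: "inj_on T (carrier_vec N)"
  proof (rule inj_onI, rule eq_vecI)
    fix v w t assume vw: "v \<in> carrier_vec N" "w \<in> carrier_vec N" "T v = T w" and "t < dim_vec w"
    then have t: "t < N" by simp
    have "T v $$ (t div n, t mod n) = T w $$ (t div n, t mod n)" using vw by simp
    then show "v $ t = w $ t" using code_low[OF t] by (simp add: T_def)
  qed auto
  have surj: "T ` carrier_vec N = centrosymmetric n"
  proof
    show "centrosymmetric n \<subseteq> T ` carrier_vec N"
    proof
      fix M assume M: "M \<in> centrosymmetric n"
      \<comment> \<open>The preimage reads \<open>M\<close> at the position whose row-major number
        is \<open>t\<close>.\<close>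
      have "M = T (vec N (\<lambda>t. M $$ (t div n, t mod n)))"
      proof (rule eq_matI)
        fix i j
        assume "i < dim_row (T (vec N (\<lambda>t. M $$ (t div n, t mod n))))"
          and "j < dim_col (T (vec N (\<lambda>t. M $$ (t div n, t mod n))))"
        then have ij: "i < n" "j < n" by (auto simp: T_def)
        \<comment> \<open>The code numbers either the position itself or its mirror image, and
          \<open>M\<close> has the same entry at both.\<close>
        have "code i j = i * n + j \<or> code i j = (n - Suc i) * n + (n - Suc j)"
          unfolding reflect[OF ij] by (simp add: code_def min_def)
        moreover have "(a * n + b) div n = a" "(a * n + b) mod n = b" if "b < n" for a b
          using that by auto
        ultimately have "M $$ (code i j div n, code i j mod n) = M $$ (i, j)"
          using ij centrosymmetricD(2)[OF M ij] by (metis diff_Suc_less assms)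
        then show "M $$ (i, j) = T (vec N (\<lambda>t. M $$ (t div n, t mod n))) $$ (i, j)"
          using ij code_less[OF ij] by (simp add: T_def)
      qed (use centrosymmetricD(1)[OF M] in \<open>auto simp: T_def\<close>)
      then show "M \<in> T ` carrier_vec N" by (rule image_eqI) simp
    qed
  qed (use T_cs in auto)
  have "vectorspace.dim complex_field (module_vec TYPE(complex) N) =
      mat_dim n (centrosymmetric n)"
    by (rule dim_eq) (use inj surj U.fin_dim in \<open>auto simp: module_vec_simps\<close>)
  then show ?thesis using U.dim_is_n by (simp add: N_def)
qed

theorem theorem7p4:
  fixes n m :: nat
  assumes "n \<ge> 2"
    and "m \<in> vertices n"
    and "n = 2 * m - 1"
  shows "T2 n (path_edges n) m = T3 n (path_edges n) m \<and>
    T3 n (path_edges n) m = T4 n (path_edges n) m \<and>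
    algebra_isomorphic complex_field (mat_subalgebra n (T4 n (path_edges n) m))
      (algebra_direct_sum (mat_algebra m) (mat_algebra (m - 1))) \<and>
    (\<forall>T \<in> {T2 n (path_edges n) m, T3 n (path_edges n) m, T4 n (path_edges n) m}.
      real (mat_dim n T) = 2 * real m ^ 2 - 2 * real m + 1 \<and>
      real (mat_dim n T) = (real n ^ 2 + 1) / 2)"
proof -
  \<comment> \<open>The size becomes \<open>Suc (2 * p)\<close> and the middle vertex
    \<open>Suc p\<close>, free of natural subtraction.\<close>
  define p where "p = m - 1"
  have m: "m = Suc p" and n: "n = Suc (2 * p)" using assms by (auto simp: p_def)
  have T: "T2 n (path_edges n) m = centrosymmetric n" "T3 n (path_edges n) m = centrosymmetric n"
    "T4 n (path_edges n) m = centrosymmetric n"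
    using T2_path_middle T2_eq_T3_path_middle T4_path_middle unfolding m n by auto
  have "mat_dim n (centrosymmetric n) = (n\<^sup>2 + 1) div 2" by (rule dim_centrosymmetric) (simp add: n)
  \<comment> \<open>The number is even, so the division is exact and carries over to the
    reals.\<close>
  also have "n\<^sup>2 + 1 = 2 * (2 * p\<^sup>2 + 2 * p + 1)"
    by (simp add: n power2_eq_square algebra_simps)
  finally have "mat_dim n (centrosymmetric n) = 2 * p\<^sup>2 + 2 * p + 1" by simp
  then have "real (mat_dim n (centrosymmetric n)) = 2 * real m ^ 2 - 2 * real m + 1"
    "real (mat_dim n (centrosymmetric n)) = (real n ^ 2 + 1) / 2"
    by (simp_all add: m n power2_eq_square field_simps)
  then show ?thesis
    using centrosymmetric_algebra_isomorphic[of p] unfolding T by (simp add: m n)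
qed

end
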